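(* Let $G$ be a marked group and let $T_G$ be its subgroup tree. Then $T_G$ is well-founded if and only if $G$ satisfies the maximal condition on subgroups.
   Context: Let $\mathbb{F}_\omega$ be the free group on countably many letters, with a fixed enumeration $(\gamma_i)_{i\in\mathbb{N}}$ of its elements. A marked group is $G=\mathbb{F}_\omega/N$ with $N\trianglelefteq\mathbb{F}_\omega$; it carries the enumeration $g_i:=\gamma_iN$, $i\in\mathbb{N}$ (repetitions allowed). For $s=(s_0,\dots,s_n)\in\mathbb{N}^{<\mathbb{N}}$ write $\{g_s\}=\{g_{s_0},\dots,g_{s_n}\}$, with $\{g_\emptyset\}=\emptyset$. $G$ satisfies the maximal condition on subgroups if there is no infinite strictly increasing chain $H_0<H_1<\cdots$ of subgroups of $G$. The subgroup tree $T_G\subseteq\mathbb{N}^{<\mathbb{N}}$ is defined recursively, writing $(s,i)$ for the sequence $s$ extended by the term $i$: $\emptyset\in T_G$; and if $s\in T_G$ and $i\in\mathbb{N}$, then $(s,i)\in T_G$ if and only if $\langle\{g_s\}\cup\{g_i\}\rangle\ne\langle\{g_s\}\rangle$ (where $\langle\emptyset\rangle=\{e\}$). A tree $T\subseteq\mathbb{N}^{<\mathbb{N}}$ (a set of finite sequences closed under initial segments) is well-founded if there is no $x\in\mathbb{N}^{\mathbb{N}}$ all of whose finite initial segments lie in $T$. *)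

theory Defs
  imports "HOL-Algebra.Algebra" "HOL-Library.Sublist"
begin

text \<open>
  The free group on an alphabet \<open>'a\<close>, realised as the group of reduced words. A letter
  \<open>(b, a)\<close> stands for the generator \<open>a\<close> if \<open>b\<close> holds and for its formal inverse otherwise;
  multiplication is concatenation followed by free reduction, one letter at a time.
\<close>

type_synonym 'a letter = "bool \<times> 'a"

fun inv_letter :: "'a letter \<Rightarrow> 'a letter" where
  "inv_letter (b, a) = (\<not> b, a)"

fun reduced :: "'a letter list \<Rightarrow> bool" where
  "reduced (x # y # w) \<longleftrightarrow> y \<noteq> inv_letter x \<and> reduced (y # w)"
| "reduced _ \<longleftrightarrow> True"

fun cancel_cons :: "'a letter \<Rightarrow> 'a letter list \<Rightarrow> 'a letter list" where
  "cancel_cons x [] = [x]"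
| "cancel_cons x (y # w) = (if y = inv_letter x then w else x # y # w)"

definition free_group :: "'a letter list monoid" where
  "free_group =
     \<lparr>carrier = {w. reduced w}, monoid.mult = (\<lambda>u v. foldr cancel_cons u v), one = []\<rparr>"

abbreviation F_omega :: "nat letter list monoid" where
  "F_omega \<equiv> free_group"

lemma inv_letter_invol [simp]: "inv_letter (inv_letter x) = x"
  by (cases x) simp

lemma inv_letter_neq [simp]: "inv_letter x \<noteq> x" "x \<noteq> inv_letter x"
  by (cases x; simp)+

lemma reduced_tl: "reduced (x # w) \<Longrightarrow> reduced w"
  by (cases w) auto

lemma reduced_cancel_cons: "reduced w \<Longrightarrow> reduced (cancel_cons x w)"
  by (cases w) (auto dest: reduced_tl)

lemma reduced_foldr: "reduced v \<Longrightarrow> reduced (foldr cancel_cons u v)"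
  by (induction u) (auto intro: reduced_cancel_cons)

lemma cancel_cons_inv:
  assumes "reduced w"
  shows "cancel_cons (inv_letter x) (cancel_cons x w) = w"
proof (cases w)
  case (Cons y v)
  then show ?thesis using assms by (cases v) auto
qed simp

lemma foldr_cancel_cons_step:
  assumes "reduced w"
  shows "foldr cancel_cons (cancel_cons x u) w = cancel_cons x (foldr cancel_cons u w)"
proof (cases u)
  case (Cons y v)
  then show ?thesis
    using cancel_cons_inv[OF reduced_foldr[OF assms], of "inv_letter x" v] by auto
qed simp

lemma foldr_cancel_cons_assoc:
  assumes "reduced w"
  shows "foldr cancel_cons (foldr cancel_cons u v) w
       = foldr cancel_cons u (foldr cancel_cons v w)"
  by (induction u) (simp_all add: foldr_cancel_cons_step[OF assms])

lemma foldr_cancel_cons_Nil: "reduced w \<Longrightarrow> foldr cancel_cons w [] = w"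
proof (induction w)
  case (Cons x w)
  then show ?case by (cases w) auto
qed simp

lemma left_inverse_word:
  "reduced w \<Longrightarrow> foldr cancel_cons (map inv_letter (rev w)) w = []"
proof (induction w)
  case (Cons x w)
  then show ?case by (auto dest: reduced_tl)
qed simp

lemma group_free_group: "group (free_group :: 'a letter list monoid)"
proof (rule groupI)
  fix w :: "'a letter list"
  assume "w \<in> carrier free_group"
  then have w: "reduced w" by (simp add: free_group_def)
  let ?v = "foldr cancel_cons (map inv_letter (rev w)) []"
  have "foldr cancel_cons ?v w = []"
    using w by (simp only: foldr_cancel_cons_assoc left_inverse_word foldr.simps id_apply)
  then show "\<exists>v \<in> carrier free_group. v \<otimes>\<^bsub>free_group\<^esub> w = \<one>\<^bsub>free_group\<^esub>"
    by (intro bexI[of _ ?v]) (auto simp: free_group_def reduced_foldr)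
qed (auto simp: free_group_def reduced_foldr foldr_cancel_cons_assoc)

definition max_condition_subgroups :: "('a, 'b) monoid_scheme \<Rightarrow> bool" where
  "max_condition_subgroups G \<longleftrightarrow>
     \<not> (\<exists>H :: nat \<Rightarrow> 'a set. (\<forall>n. subgroup (H n) G) \<and> (\<forall>n. H n \<subset> H (Suc n)))"

inductive_set subgroup_tree :: "('a, 'b) monoid_scheme \<Rightarrow> (nat \<Rightarrow> 'a) \<Rightarrow> nat list set"
  for G and g where
  Nil: "[] \<in> subgroup_tree G g"
| snoc: "\<lbrakk>s \<in> subgroup_tree G g; generate G (g ` set s \<union> {g i}) \<noteq> generate G (g ` set s)\<rbrakk>
    \<Longrightarrow> s @ [i] \<in> subgroup_tree G g"

definition is_tree :: "nat list set \<Rightarrow> bool" where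
  "is_tree T \<longleftrightarrow> (\<forall>s t. t \<in> T \<and> prefix s t \<longrightarrow> s \<in> T)"

definition well_founded_tree :: "nat list set \<Rightarrow> bool" where
  "well_founded_tree T \<longleftrightarrow> is_tree T \<and> \<not> (\<exists>x :: nat \<Rightarrow> nat. \<forall>n. map x [0..<n] \<in> T)"

lemma is_tree_subgroup_tree: "is_tree (subgroup_tree G g)"
proof -
  have "s \<in> subgroup_tree G g" if "t \<in> subgroup_tree G g" "prefix s t" for s t
    using that by induction (auto intro: subgroup_tree.intros)
  then show ?thesis by (auto simp: is_tree_def)
qed

end

theory Submission
  imports Defs
begin

text \<open>
  An infinite branch \<open>x\<close> of the subgroup tree is the same thing as a sequence \<open>g (x 0), g (x 1), \<dots>\<close>
  of group elements each of which properly enlarges the subgroup generated by its predecessors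
  (\<open>subgroup_tree_branch_iff\<close>). The subgroups generated by the initial segments of such a branch form a strictly increasing chain
  (\<open>not_max_condition_of_branch\<close>).
  Conversely, out of a strictly increasing chain \<open>H 0 < H 1 < \<dots>\<close> one picks elements
  \<open>g (x n) \<in> H (Suc n) - H n\<close>, which is possible because \<open>g\<close> enumerates the whole group. The first
  \<open>n\<close> of them lie in \<open>H n\<close>, hence so does the subgroup they generate, whereas the next one does not;
  therefore \<open>x\<close> is a branch (\<open>branch_of_not_max_condition\<close>).

  The argument takes place in an arbitrary group enumerated by \<open>g\<close>; a marked group is an instance
  because every coset of \<open>N\<close> has the form \<open>\<gamma> i N\<close>.
\<close>

lemma snoc_in_subgroup_tree_iff:
  "s @ [i] \<in> subgroup_tree G g \<longleftrightarrow>
     s \<in> subgroup_tree G g \<and> generate G (g ` set s \<union> {g i}) \<noteq> generate G (g ` set s)"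
  using subgroup_tree.snoc[of s G g i] subgroup_tree.cases[of "s @ [i]" G g] by blast

lemma subgroup_tree_branch_iff:
  "(\<forall>n. map x [0..<n] \<in> subgroup_tree G g) \<longleftrightarrow>
     (\<forall>n. generate G (g ` x ` {..<Suc n}) \<noteq> generate G (g ` x ` {..<n}))"
proof -
  have step: "map x [0..<Suc n] \<in> subgroup_tree G g \<longleftrightarrow>
      map x [0..<n] \<in> subgroup_tree G g \<and>
      generate G (g ` x ` {..<Suc n}) \<noteq> generate G (g ` x ` {..<n})" for n
  proof -
    have "g ` set (map x [0..<n]) = g ` x ` {..<n}"
      by (simp add: atLeast0LessThan)
    moreover have "g ` set (map x [0..<n]) \<union> {g (x n)} = g ` x ` {..<Suc n}"
      by (auto simp: lessThan_Suc atLeast0LessThan)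
    ultimately show ?thesis
      using snoc_in_subgroup_tree_iff[of "map x [0..<n]" "x n" G g] by simp
  qed
  show ?thesis
  proof
    assume "\<forall>n. map x [0..<n] \<in> subgroup_tree G g"
    then show "\<forall>n. generate G (g ` x ` {..<Suc n}) \<noteq> generate G (g ` x ` {..<n})"
      using step by blast
  next
    assume "\<forall>n. generate G (g ` x ` {..<Suc n}) \<noteq> generate G (g ` x ` {..<n})"
    then have "map x [0..<n] \<in> subgroup_tree G g" for n
      by (induction n) (use step in \<open>auto simp: subgroup_tree.Nil simp del: upt_Suc\<close>)
    then show "\<forall>n. map x [0..<n] \<in> subgroup_tree G g" ..
  qed
qed

lemma (in group) not_max_condition_of_branch:
  assumes "range g \<subseteq> carrier G"
    and "\<forall>n. map x [0..<n] \<in> subgroup_tree G g"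
  shows "\<not> max_condition_subgroups G"
proof -
  let ?H = "\<lambda>n. generate G (g ` x ` {..<n})"
  have "subgroup (?H n) G" for n
    by (rule generate_is_subgroup) (use assms(1) in auto)
  moreover have "?H n \<subset> ?H (Suc n)" for n
    using assms(2) mono_generate[of "g ` x ` {..<n}" "g ` x ` {..<Suc n}"]
    unfolding subgroup_tree_branch_iff by (auto simp: lessThan_Suc)
  ultimately show ?thesis
    unfolding max_condition_subgroups_def not_not by (intro exI[of _ ?H]) simp
qed

lemma (in group) branch_of_not_max_condition:
  assumes "carrier G \<subseteq> range g"
    and "\<not> max_condition_subgroups G"
  obtains x where "\<forall>n. map x [0..<n] \<in> subgroup_tree G g"
proof -
  obtain H :: "nat \<Rightarrow> 'a set"
    where H: "\<And>n. subgroup (H n) G" and strict: "\<And>n. H n \<subset> H (Suc n)"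
    using assms(2) unfolding max_condition_subgroups_def by blast
  have "\<exists>i. g i \<in> H (Suc n) - H n" for n
    using strict[of n] subgroup.subset[OF H, of "Suc n"] assms(1) by blast
  then obtain x where new: "\<And>n. g (x n) \<in> H (Suc n) - H n"
    by metis
  have mono: "H m \<subseteq> H n" if "m \<le> n" for m n
    by (rule lift_Suc_mono_le[of H, OF psubset_imp_subset[OF strict] that])
  have "generate G (g ` x ` {..<Suc n}) \<noteq> generate G (g ` x ` {..<n})" for n
  proof -
    have "g ` x ` {..<n} \<subseteq> H n"
    proof clarify
      fix m assume "m < n"
      then show "g (x m) \<in> H n"
        using new[of m] mono[of "Suc m" n] by auto
    qed
    then have "generate G (g ` x ` {..<n}) \<subseteq> H n"
      by (rule generate_subgroup_incl[OF _ H])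
    then have "g (x n) \<notin> generate G (g ` x ` {..<n})"
      using new by blast
    moreover have "g (x n) \<in> generate G (g ` x ` {..<Suc n})"
      by (intro generate.incl imageI) simp
    ultimately show ?thesis by blast
  qed
  then show thesis
    using that[of x] by (simp add: subgroup_tree_branch_iff)
qed

lemma (in group) well_founded_subgroup_tree_iff:
  assumes "range g = carrier G"
  shows "well_founded_tree (subgroup_tree G g) \<longleftrightarrow> max_condition_subgroups G"
  using not_max_condition_of_branch[of g] branch_of_not_max_condition[of g] assms
  unfolding well_founded_tree_def by (metis is_tree_subgroup_tree order_refl)

text \<open>
  The quotient is built from right cosets whereas the marking uses left cosets; for a normal
  subgroup these agree.
\<close>

lemma (in normal) range_l_coset_eq_carrier_FactGroup:
  assumes "range \<gamma> = carrier G"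
  shows "range (\<lambda>i. \<gamma> i <#\<^bsub>G\<^esub> H) = carrier (G Mod H)"
proof -
  have "range (\<lambda>i. \<gamma> i <#\<^bsub>G\<^esub> H) = (\<lambda>a. a <#\<^bsub>G\<^esub> H) ` carrier G"
    unfolding assms[symmetric] by (simp add: image_image)
  also have "\<dots> = (\<lambda>a. H #>\<^bsub>G\<^esub> a) ` carrier G"
    using coset_eq by (intro image_cong) auto
  also have "\<dots> = carrier (G Mod H)"
    by (auto simp: FactGroup_def RCOSETS_def)
  finally show ?thesis .
qed

theorem lemma4p3:
  fixes N :: "nat letter list set" and \<gamma> :: "nat \<Rightarrow> nat letter list"
  assumes "range \<gamma> = carrier F_omega"
    and "N \<lhd> F_omega"
  shows "well_founded_tree (subgroup_tree (F_omega Mod N) (\<lambda>i. \<gamma> i <#\<^bsub>F_omega\<^esub> N))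
     \<longleftrightarrow> max_condition_subgroups (F_omega Mod N)"
  using group.well_founded_subgroup_tree_iff[OF normal.factorgroup_is_group[OF assms(2)]
      normal.range_l_coset_eq_carrier_FactGroup[OF assms(2,1)]] .

end
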